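(* Let $J=[0,1]$, let $m\ge 2$ be an integer, let $0<\eta_1<\dots<\eta_m\le 1$, let $\alpha_1,\dots,\alpha_{m-1}\in\mathbb{R}$ and $\beta_1,\dots,\beta_m\in\mathbb{R}$, and assume that $$\mu := 1-\Big(\sum_{i=1}^{m-1}\alpha_i(\eta_{i+1}-\eta_i)+\sum_{i=1}^{m}\beta_i\Big)\neq 0 .$$ Let $f:J\times\mathbb{R}\to\mathbb{R}$ be continuous and suppose there is a constant $L>0$ such that $$|f(t,u_1)-f(t,u_2)|\le L|u_1-u_2|\quad\text{for all }t\in J,\ u_1,u_2\in\mathbb{R}.$$ Let $p>1$ be a real number and put $$\Phi=\bigg(\int_0^1|G(1,s)|^p ds\bigg)^{1/p}+\frac{1}{|\mu|}\sum_{i=1}^{m-1}|\alpha_i|\bigg(\int_0^1\Big|\int_{\eta_i}^{\eta_{i+1}}G(\tau,s)\,d\tau\Big|^p ds\bigg)^{1/p}+\frac{1}{|\mu|}\sum_{i=1}^{m}|\beta_i|\bigg(\int_0^1|G(\eta_i,s)|^p ds\bigg)^{1/p},$$ where $G:J\times J\to\mathbb{R}$ is the function defined in the context. Assume that $L\Phi<1$. Then the boundary value problem $$u^{(6)}(t)+f(t,u(t))=0,\quad t\in(0,1),$$ $$u^{(j)}(0)=0\ (1\le j\le 4),\qquad u''(1)=0,\qquad u(0)=\sum_{i=1}^{m-1}\alpha_i\int_{\eta_i}^{\eta_{i+1}}u(s)\,ds+\sum_{i=1}^{m}\beta_i u(\eta_i)$$ has a unique solution.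
   Context: The function $G$ is $$G(t,s)=\frac{1}{5!}\begin{cases}t^5(1-s)^3-(t-s)^5,&0\le s\le t\le 1,\\ t^5(1-s)^3,&0\le t\le s\le 1.\end{cases}$$ A solution of the boundary value problem is a function $u\in C^6([0,1],\mathbb{R})$ (one-sided derivatives at the endpoints) satisfying the differential equation on $(0,1)$ and all the boundary conditions. *)

theory Defs
  imports "HOL-Analysis.Analysis"
begin

text \<open>\<open>k\<close>-th derivative of a function on a set \<open>S\<close>, always taken relative to \<open>S\<close>: for a compact
  interval this is the ordinary derivative in the interior and the one-sided derivative at the
  endpoints. The value is meaningful only where the relevant derivatives exist.\<close>

fun deriv_within :: "real set \<Rightarrow> nat \<Rightarrow> (real \<Rightarrow> real) \<Rightarrow> real \<Rightarrow> real" where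
  "deriv_within S 0 u = u"
| "deriv_within S (Suc k) u = (\<lambda>t. vector_derivative (deriv_within S k u) (at t within S))"

definition Ck_on :: "nat \<Rightarrow> real set \<Rightarrow> (real \<Rightarrow> real) \<Rightarrow> bool" where
  "Ck_on k S u \<longleftrightarrow>
     (\<forall>j<k. deriv_within S j u differentiable_on S) \<and> continuous_on S (deriv_within S k u)"

definition G :: "real \<Rightarrow> real \<Rightarrow> real" where
  "G t s = 1 / fact 5 *
     (if s \<le> t then t ^ 5 * (1 - s) ^ 3 - (t - s) ^ 5 else t ^ 5 * (1 - s) ^ 3)"

definition mu :: "nat \<Rightarrow> (nat \<Rightarrow> real) \<Rightarrow> (nat \<Rightarrow> real) \<Rightarrow> (nat \<Rightarrow> real) \<Rightarrow> real" where
  "mu m \<eta> \<alpha> \<beta> = 1 - ((\<Sum>i=1..m-1. \<alpha> i * (\<eta> (i + 1) - \<eta> i)) + (\<Sum>i=1..m. \<beta> i))"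

definition Phi :: "real \<Rightarrow> nat \<Rightarrow> (nat \<Rightarrow> real) \<Rightarrow> (nat \<Rightarrow> real) \<Rightarrow> (nat \<Rightarrow> real) \<Rightarrow> real" where
  "Phi p m \<eta> \<alpha> \<beta> =
     (integral {0..1} (\<lambda>s. \<bar>G 1 s\<bar> powr p)) powr (1 / p)
     + 1 / \<bar>mu m \<eta> \<alpha> \<beta>\<bar> *
         (\<Sum>i=1..m-1. \<bar>\<alpha> i\<bar> *
            (integral {0..1} (\<lambda>s. \<bar>integral {\<eta> i..\<eta> (i + 1)} (\<lambda>\<tau>. G \<tau> s)\<bar> powr p)) powr (1 / p))
     + 1 / \<bar>mu m \<eta> \<alpha> \<beta>\<bar> *
         (\<Sum>i=1..m. \<bar>\<beta> i\<bar> * (integral {0..1} (\<lambda>s. \<bar>G (\<eta> i) s\<bar> powr p)) powr (1 / p))"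

text \<open>Only the values of \<open>u\<close> on \<open>[0, 1]\<close> matter here; uniqueness of a solution therefore means
  uniqueness of its restriction to \<open>[0, 1]\<close>.\<close>

definition bvp_solution ::
  "(real \<Rightarrow> real \<Rightarrow> real) \<Rightarrow> nat \<Rightarrow> (nat \<Rightarrow> real) \<Rightarrow> (nat \<Rightarrow> real) \<Rightarrow> (nat \<Rightarrow> real) \<Rightarrow> (real \<Rightarrow> real) \<Rightarrow> bool"
where
  "bvp_solution f m \<eta> \<alpha> \<beta> u \<longleftrightarrow>
     Ck_on 6 {0..1} u \<and>
     (\<forall>t\<in>{0<..<1}. deriv_within {0..1} 6 u t + f t (u t) = 0) \<and>
     (\<forall>j\<in>{1..4}. deriv_within {0..1} j u 0 = 0) \<and>
     deriv_within {0..1} 2 u 1 = 0 \<and>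
     u 0 = (\<Sum>i=1..m-1. \<alpha> i * integral {\<eta> i..\<eta> (i + 1)} u) + (\<Sum>i=1..m. \<beta> i * u (\<eta> i))"

end

theory Submission
  imports Defs
begin

text \<open>Taylor's formula with integral remainder turns the boundary value problem into the fixed point
  equation \<open>u t = c + \<integral> G t s * f s (u s) ds\<close>, where the nonlocal condition determines the constant
  \<open>c\<close> because \<open>\<mu> \<noteq> 0\<close>. In the sup norm this operator has Lipschitz constant at most \<open>L \<Phi>\<close>: one has
  \<open>0 \<le> G t s \<le> G 1 s\<close>, and on the unit interval the \<open>L\<^sup>1\<close> norm of a kernel is bounded by its
  \<open>L\<^sup>p\<close> norm, so the conjugate exponent is not needed. Banach's theorem finishes the proof.\<close>

section \<open>Norm comparison on the unit interval and a fixed point principle\<close>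

text \<open>Young's inequality is integrated pointwise. With \<open>a\<close> the integral of
  \<open>\<bar>K s\<bar>\<close> and \<open>I\<close> that of its \<open>p\<close>-th power, an
  interval of length 1 gives \<open>a powr p \<le> I / p + a powr p / q\<close>. Absorbing the last
  term on the left leaves \<open>a powr p \<le> I\<close>.\<close>

lemma integral_abs_le_powr_mean:
  fixes K :: "real \<Rightarrow> real"
  assumes K: "continuous_on {0..1} K" and p: "p > 1"
  shows "integral {0..1} (\<lambda>s. \<bar>K s\<bar>) \<le> (integral {0..1} (\<lambda>s. \<bar>K s\<bar> powr p)) powr (1 / p)"
proof -
  define a where "a = integral {0..1} (\<lambda>s. \<bar>K s\<bar>)"
  have K1: "(\<lambda>s. \<bar>K s\<bar>) integrable_on {0..1}"
    by (intro integrable_continuous_real continuous_intros K)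
  have Kp: "(\<lambda>s. \<bar>K s\<bar> powr p) integrable_on {0..1}"
    using p by (intro integrable_continuous_real continuous_on_powr' continuous_intros K) auto
  have "a \<ge> 0"
    unfolding a_def by (rule integral_nonneg[OF K1]) simp
  show ?thesis
  proof (cases "a = 0")
    case True
    then show ?thesis by (simp add: a_def)
  next
    case False
    with \<open>a \<ge> 0\<close> have a: "a > 0" by simp
    have const: "((\<lambda>_. c) has_integral c) {0..1 :: real}" for c :: real
      using has_integral_const_real[of c 0 1] by simp
    define I where "I = integral {0..1} (\<lambda>s. \<bar>K s\<bar> powr p)"
    define q where "q = p / (p - 1)"
    have q: "q > 1" "1 / p + 1 / q = 1"
      using p by (auto simp: q_def field_simps)
    \<comment> \<open>The second factor is chosen so that its \<open>q\<close>-th power is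
      \<open>a powr p\<close>, because \<open>(p - 1) * q = p\<close>.\<close>
    have young: "\<bar>K s\<bar> * a powr (p - 1) \<le> \<bar>K s\<bar> powr p / p + a powr p / q" for s
      using Youngs_inequality[OF p q, of "\<bar>K s\<bar>" "a powr (p - 1)"] p by (simp add: powr_powr q_def)
    have lhs: "((\<lambda>s. \<bar>K s\<bar> * a powr (p - 1)) has_integral a * a powr (p - 1)) {0..1}"
      unfolding a_def by (intro has_integral_mult_left integrable_integral K1)
    have rhs: "((\<lambda>s. \<bar>K s\<bar> powr p / p + a powr p / q) has_integral I / p + a powr p / q) {0..1}"
      unfolding I_def by (rule has_integral_add[OF has_integral_divide[OF integrable_integral[OF Kp]] const])
    have "a powr p = a * a powr (p - 1)"
      using a by (simp add: powr_diff)
    also have "\<dots> \<le> I / p + a powr p / q"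
      by (rule has_integral_le[OF lhs rhs young])
    finally have "a powr p * (1 - 1 / q) \<le> I / p"
      by (simp add: right_diff_distrib)
    also have "1 - 1 / q = 1 / p" using q by simp
    finally have "a powr p \<le> I" using p by (simp add: divide_simps)
    then have "(a powr p) powr (1 / p) \<le> I powr (1 / p)"
      using p by (intro powr_mono2) auto
    then show ?thesis
      using a p by (simp add: powr_powr a_def I_def)
  qed
qed

text \<open>Banach's theorem is applied in the complete space of bounded continuous functions on the
  whole line, into which continuous functions on \<open>{a..b}\<close> embed by
  \<open>clamp\<close>. The hypothesis \<open>contr\<close> is phrased with an arbitrary pointwise
  bound \<open>M\<close>, so that an application never has to handle the sup norm.\<close>

lemma contraction_on_continuous_fixpoint:
  fixes T :: "(real \<Rightarrow> real) \<Rightarrow> real \<Rightarrow> real"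
  assumes "a \<le> b" and c: "0 \<le> c" "c < 1"
    and T: "\<And>u. continuous_on {a..b} u \<Longrightarrow> continuous_on {a..b} (T u)"
    and contr: "\<And>u v M t. continuous_on {a..b} u \<Longrightarrow> continuous_on {a..b} v \<Longrightarrow>
      (\<And>s. s \<in> {a..b} \<Longrightarrow> \<bar>u s - v s\<bar> \<le> M) \<Longrightarrow> t \<in> {a..b} \<Longrightarrow> \<bar>T u t - T v t\<bar> \<le> c * M"
  shows "\<exists>u. continuous_on {a..b} u \<and> (\<forall>t\<in>{a..b}. u t = T u t) \<and>
    (\<forall>v. continuous_on {a..b} v \<and> (\<forall>t\<in>{a..b}. v t = T v t) \<longrightarrow> (\<forall>t\<in>{a..b}. v t = u t))"
proof -
  have clamp: "clamp a b x \<in> {a..b}" for x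
    using clamp_in_interval[of a b x] \<open>a \<le> b\<close> by simp
  have "\<exists>g :: real \<Rightarrow>\<^sub>C real. \<forall>x. g x = v (clamp a b x)" if "continuous_on {a..b} v" for v :: "real \<Rightarrow> real"
    using continuous_on_cbox_bcontfunE[of a b v] that by (metis box_real(2))
  \<comment> \<open>\<open>E v\<close> extends \<open>v\<close> beyond \<open>{a..b}\<close> by its
    endpoint values. The contraction on the function space is \<open>T\<close> followed by this
    extension.\<close>
  then obtain E :: "(real \<Rightarrow> real) \<Rightarrow> real \<Rightarrow>\<^sub>C real"
    where E: "\<And>v x. continuous_on {a..b} v \<Longrightarrow> E v x = v (clamp a b x)"
    by metis
  have E': "E v x = v x" if "continuous_on {a..b} v" "x \<in> {a..b}" for v x
    using E[OF that(1), of x] clamp_cancel_cbox[of x a b] that by simp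
  have TE: "E (T w) x = T w (clamp a b x)" for w :: "real \<Rightarrow>\<^sub>C real" and x
    by (simp add: E T)
  have "\<exists>!w. E (T (apply_bcontfun w)) = w"
  proof (rule banach_fix_type[OF c], intro allI dist_bound)
    fix v w :: "real \<Rightarrow>\<^sub>C real" and x
    show "dist (E (T v) x) (E (T w) x) \<le> c * dist v w"
      unfolding TE dist_real_def
      by (rule contr) (use dist_bounded[of v _ w] clamp in \<open>auto simp: dist_real_def\<close>)
  qed
  then obtain w :: "real \<Rightarrow>\<^sub>C real"
    where w: "E (T w) = w" and uniq: "\<And>v. E (T (apply_bcontfun v)) = v \<Longrightarrow> v = w"
    by blast
  have "v t = w t"
    if v: "continuous_on {a..b} v" "\<And>t. t \<in> {a..b} \<Longrightarrow> v t = T v t" and t: "t \<in> {a..b}" for v t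
  proof -
    \<comment> \<open>The contraction bound with \<open>M = 0\<close> shows that \<open>T\<close> on
      \<open>{a..b}\<close> depends only on values in \<open>{a..b}\<close>. Hence any fixed point
      \<open>v\<close> on the interval extends to a fixed point in the function space.\<close>
    have TEv: "T (E v) t = T v t" if "t \<in> {a..b}" for t
      using contr[of "E v" v 0 t] that v(1) by (simp add: E')
    then have "E (T (E v)) = E v"
      using clamp by (intro bcontfun_eqI) (simp only: TE TEv E[OF v(1)] v(2)[symmetric])
    from uniq[OF this] show ?thesis
      using E'[OF v(1) t] by simp
  qed
  moreover have "w t = T w t" if "t \<in> {a..b}" for t
    using E'[OF T[of w] that] w by simp
  ultimately show ?thesis
    by (intro exI[of _ "apply_bcontfun w"] conjI) (simp, blast+)
qed

section \<open>Continuity and bounds of the kernel\<close>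

text \<open>Replacing the case split by a positive part makes joint continuity of \<open>G\<close> a
  matter of composition.\<close>

lemma G_eq_max: "G t s = (t ^ 5 * (1 - s) ^ 3 - (max 0 (t - s)) ^ 5) / fact 5"
  by (auto simp: G_def max_def)

lemma continuous_on_G_compose [continuous_intros]:
  fixes g h :: "'a :: topological_space \<Rightarrow> real"
  assumes "continuous_on A g" "continuous_on A h"
  shows "continuous_on A (\<lambda>x. G (g x) (h x))"
  unfolding G_eq_max using assms by (intro continuous_intros) auto

text \<open>On the unit square \<open>t - s \<le> t * (1 - s)\<close>. After taking fifth powers,
  \<open>(1 - s) ^ 5\<close> is bounded by \<open>(1 - s) ^ 3\<close>.\<close>

lemma G_nonneg:
  assumes "t \<in> {0..1}" "s \<in> {0..1}"
  shows "G t s \<ge> 0"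
proof -
  have "(max 0 (t - s)) ^ 5 \<le> (t * (1 - s)) ^ 5"
    using assms mult_left_le[of s t] mult_left_le[of t s] by (intro power_mono) (auto simp: algebra_simps)
  also have "\<dots> \<le> t ^ 5 * (1 - s) ^ 3"
    using assms by (auto simp: power_mult_distrib intro!: mult_left_mono power_decreasing)
  finally show ?thesis by (simp add: G_eq_max)
qed

text \<open>For \<open>s \<le> t\<close> the polynomial branch is nondecreasing from
  \<open>t\<close> to 1, by the sign of its derivative. For \<open>t < s\<close> the two values are
  compared directly after factoring out \<open>(1 - s) ^ 3\<close>.\<close>

lemma G_le_G1:
  assumes t: "t \<in> {0..1}" and s: "s \<in> {0..1}"
  shows "G t s \<le> G 1 s"
proof (cases "s \<le> t")
  case True
  have "t ^ 5 * (1 - s) ^ 3 - (t - s) ^ 5 \<le> 1 ^ 5 * (1 - s) ^ 3 - (1 - s) ^ 5"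
  proof (rule DERIV_nonneg_imp_nondecreasing[where f = "\<lambda>t. t ^ 5 * (1 - s) ^ 3 - (t - s) ^ 5"])
    fix x assume x: "t \<le> x" "x \<le> 1"
    \<comment> \<open>As for nonnegativity, the source is \<open>x - s \<le> x * (1 - s)\<close>,
      now with exponent 4.\<close>
    have "(x - s) ^ 4 \<le> (x * (1 - s)) ^ 4"
      using x True t s mult_left_le[of x s] by (intro power_mono) (auto simp: algebra_simps)
    also have "\<dots> \<le> x ^ 4 * (1 - s) ^ 3"
      using x t s by (auto simp: power_mult_distrib intro!: mult_left_mono power_decreasing)
    finally have "0 \<le> 5 * x ^ 4 * (1 - s) ^ 3 - 5 * (x - s) ^ 4" by simp
    moreover have "((\<lambda>t. t ^ 5 * (1 - s) ^ 3 - (t - s) ^ 5) has_real_derivative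
        5 * x ^ 4 * (1 - s) ^ 3 - 5 * (x - s) ^ 4) (at x)"
      by (auto intro!: derivative_eq_intros)
    ultimately show "\<exists>y. ((\<lambda>t. t ^ 5 * (1 - s) ^ 3 - (t - s) ^ 5) has_real_derivative y) (at x) \<and> 0 \<le> y"
      by blast
  qed (use t in auto)
  then show ?thesis
    using True s by (auto simp: G_def intro: divide_right_mono)
next
  case False
  \<comment> \<open>The chain is \<open>t ^ 5 \<le> t < s \<le> 2 * s - s * s\<close>, and the last
    term equals \<open>1 - (1 - s) ^ 2\<close>.\<close>
  have "t ^ 5 \<le> t ^ 1"
    using t by (intro power_decreasing) auto
  moreover have "s * s \<le> s"
    using s by (simp add: mult_left_le)
  ultimately have "t ^ 5 \<le> 1 - (1 - s) ^ 2"
    using False by (simp add: power2_eq_square algebra_simps)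
  then have "t ^ 5 * (1 - s) ^ 3 \<le> (1 - (1 - s) ^ 2) * (1 - s) ^ 3"
    using s by (intro mult_right_mono) auto
  also have "\<dots> = (1 - s) ^ 3 - (1 - s) ^ 5" by (simp add: algebra_simps flip: power_add)
  finally show ?thesis
    using False s by (auto simp: G_def intro: divide_right_mono)
qed

section \<open>Iterated derivatives and antiderivatives on an interval\<close>

text \<open>A chain \<open>D\<close> of successive derivatives can stand for the iterated
  \<open>deriv_within\<close>: derivatives within a nondegenerate closed interval are unique,
  endpoints included, so induction on \<open>j\<close> applies.\<close>

lemma deriv_within_eq:
  assumes "a < b"
    and D: "\<And>j t. j < n \<Longrightarrow> t \<in> {a..b} \<Longrightarrow>
      (D j has_vector_derivative D (Suc j) t) (at t within {a..b})"
    and u: "\<And>t. t \<in> {a..b} \<Longrightarrow> u t = D 0 t"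
    and "j \<le> n" "t \<in> {a..b}"
  shows "deriv_within {a..b} j u t = D j t"
  using \<open>j \<le> n\<close> \<open>t \<in> {a..b}\<close>
proof (induction j arbitrary: t)
  case 0
  then show ?case by (simp add: u)
next
  case (Suc j)
  have "(deriv_within {a..b} j u has_vector_derivative D (Suc j) t) (at t within {a..b})"
    by (rule has_vector_derivative_transform[OF _ _ D]) (use Suc in auto)
  then show ?case
    using vector_derivative_within_closed_interval[OF \<open>a < b\<close>] Suc.prems by simp
qed

lemma Ck_onI:
  assumes "a < b"
    and D: "\<And>j t. j < n \<Longrightarrow> t \<in> {a..b} \<Longrightarrow>
      (D j has_vector_derivative D (Suc j) t) (at t within {a..b})"
    and u: "\<And>t. t \<in> {a..b} \<Longrightarrow> u t = D 0 t"
    and cont: "continuous_on {a..b} (D n)"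
  shows "Ck_on n {a..b} u"
proof -
  note eq = deriv_within_eq[where D = D, OF \<open>a < b\<close> D u]
  have "(deriv_within {a..b} j u has_vector_derivative D (Suc j) t) (at t within {a..b})"
    if "j < n" "t \<in> {a..b}" for j t
    by (rule has_vector_derivative_transform[OF _ _ D]) (use that eq in auto)
  then have "\<forall>j<n. deriv_within {a..b} j u differentiable_on {a..b}"
    unfolding differentiable_on_def by (blast intro: differentiableI_vector)
  moreover have "continuous_on {a..b} (deriv_within {a..b} n u)"
    using cont by (subst continuous_on_cong[OF refl eq]) auto
  ultimately show ?thesis by (simp add: Ck_on_def)
qed

lemma Ck_on_has_vector_derivative:
  assumes "Ck_on n S u" "j < n" "t \<in> S"
  shows "(deriv_within S j u has_vector_derivative deriv_within S (Suc j) u t) (at t within S)"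
  using assms by (simp add: Ck_on_def differentiable_on_def vector_derivative_works)

text \<open>Integrating \<open>n\<close> times from \<open>a\<close> produces the chain, with the
  \<open>c j\<close> as integration constants. In the induction step the shifted constants
  \<open>c \<circ> Suc\<close> yield the upper part of the chain, and one more integral is put in
  front.\<close>

lemma exists_antiderivative_chain:
  fixes g :: "real \<Rightarrow> real" and c :: "nat \<Rightarrow> real"
  assumes g: "continuous_on {a..b} g"
  shows "\<exists>D. D n = g \<and> (\<forall>j<n. D j a = c j) \<and>
    (\<forall>j<n. \<forall>t\<in>{a..b}. (D j has_vector_derivative D (Suc j) t) (at t within {a..b}))"
proof (induction n arbitrary: c)
  case 0
  then show ?case by auto
next
  case (Suc n)
  from Suc.IH[of "c \<circ> Suc"] obtain D where D: "D n = g" "\<forall>j<n. D j a = c (Suc j)"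
    "\<forall>j<n. \<forall>t\<in>{a..b}. (D j has_vector_derivative D (Suc j) t) (at t within {a..b})"
    by auto
  have "continuous_on {a..b} (D 0)"
    using g D by (cases n) (auto intro!: continuous_on_vector_derivative)
  then have D0: "((\<lambda>t. c 0 + integral {a..t} (D 0)) has_vector_derivative D 0 t) (at t within {a..b})"
    if "t \<in> {a..b}" for t
    using has_vector_derivative_add[OF has_vector_derivative_const
        integral_has_vector_derivative[OF _ that]] by fastforce
  let ?D = "\<lambda>j. case j of 0 \<Rightarrow> \<lambda>t. c 0 + integral {a..t} (D 0) | Suc j \<Rightarrow> D j"
  show ?case
    by (rule exI[of _ ?D]) (use D D0 in \<open>auto split: nat.splits\<close>)
qed

section \<open>Taylor's formula and the integral representation\<close>

text \<open>Both claims are Taylor expansions at 0, where the vanishing derivatives remove most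
  terms. The first shows that \<open>D 2 1 = 0\<close> determines \<open>D 5 0\<close>. Inserting
  this value into the expansion of \<open>D 0\<close> produces the kernel \<open>G\<close>.\<close>

lemma G_chain:
  fixes D :: "nat \<Rightarrow> real \<Rightarrow> real" and h :: "real \<Rightarrow> real"
  assumes D: "\<And>j t. j < 6 \<Longrightarrow> t \<in> {0..1} \<Longrightarrow>
      (D j has_vector_derivative D (Suc j) t) (at t within {0..1})"
    and D6: "\<And>t. t \<in> {0..1} \<Longrightarrow> D 6 t = - h t"
    and h: "continuous_on {0..1} h"
    and D0: "\<And>j. j \<in> {1..4} \<Longrightarrow> D j 0 = 0"
  shows G_chain_D2: "6 * D 2 1 = D 5 0 - integral {0..1} (\<lambda>s. (1 - s) ^ 3 * h s)"
    and G_chain_D0: "D 2 1 = 0 \<Longrightarrow> t \<in> {0..1} \<Longrightarrow>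
      D 0 t = D 0 0 + integral {0..1} (\<lambda>s. G t s * h s)"
proof -
  have "D (2 + 1) 0 = 0" "D (2 + 2) 0 = 0" "D 2 0 = 0" "D 1 0 = 0"
    using D0 by auto
  then have z: "D 1 0 = 0" "D (Suc 0) 0 = 0" "D 2 0 = 0" "D 3 0 = 0" "D 4 0 = 0" by simp_all
  \<comment> \<open>This expands \<open>D 2\<close> at 0 to order four and evaluates at 1. Of the
    Taylor terms only the cubic one, \<open>D 5 0 / 6\<close>, survives.\<close>
  have "((\<lambda>s. ((1 - s) ^ (4 - 1) / fact (4 - 1)) *\<^sub>R D (4 + 2) s) has_integral
      D 2 1 - (\<Sum>i<4. ((1 - 0) ^ i / fact i) *\<^sub>R D (i + 2) 0)) {0..1}"
    by (rule Taylor_has_integral[where Df = "\<lambda>i. D (i + 2)"]) (use D in \<open>auto simp: numeral_2_eq_2\<close>)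
  then have "((\<lambda>s. ((1 - s) ^ 3 / 6) * D 6 s) has_integral D 2 1 - D 5 0 / 6) {0..1}"
    using z by (simp add: eval_nat_numeral)
  then have "((\<lambda>s. - 6 * (((1 - s) ^ 3 / 6) * D 6 s)) has_integral - 6 * (D 2 1 - D 5 0 / 6)) {0..1}"
    by (rule has_integral_mult_right)
  then have "((\<lambda>s. (1 - s) ^ 3 * h s) has_integral - 6 * (D 2 1 - D 5 0 / 6)) {0..1}"
    by (rule has_integral_eq[rotated]) (simp add: D6)
  moreover have "- 6 * (D 2 1 - D 5 0 / 6) = D 5 0 - 6 * D 2 1" by simp
  ultimately have I: "((\<lambda>s. (1 - s) ^ 3 * h s) has_integral D 5 0 - 6 * D 2 1) {0..1}"
    by (simp only:)
  then show "6 * D 2 1 = D 5 0 - integral {0..1} (\<lambda>s. (1 - s) ^ 3 * h s)"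
    by (simp add: integral_unique)
  assume D21: "D 2 1 = 0" and t: "t \<in> {0..1}"
  have sub: "{0..t} \<subseteq> {0..1}" using t by auto
  have "((\<lambda>s. ((t - s) ^ (6 - 1) / fact (6 - 1)) *\<^sub>R D 6 s) has_integral
      D 0 t - (\<Sum>i<6. ((t - 0) ^ i / fact i) *\<^sub>R D i 0)) {0..t}"
    by (rule Taylor_has_integral)
       (use D t in \<open>auto intro: has_vector_derivative_within_subset[OF _ sub]\<close>)
  moreover have "(\<Sum>i<6. ((t - 0) ^ i / fact i) *\<^sub>R D i 0) = D 0 0 + t ^ 5 / fact 5 * D 5 0"
  proof -
    have "{..<6::nat} = {0, 1, 2, 3, 4, 5}" by auto
    then show ?thesis using z by simp
  qed
  ultimately have "((\<lambda>s. ((t - s) ^ 5 / fact 5) * D 6 s) has_integral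
      D 0 t - (D 0 0 + t ^ 5 / fact 5 * D 5 0)) {0..t}"
    by simp
  \<comment> \<open>The remainder is extended by zero from \<open>{0..t}\<close> to
    \<open>{0..1}\<close>, so that it can be added to \<open>R2\<close>. This cutoff is the case
    split in \<open>G\<close>.\<close>
  then have R1: "((\<lambda>s. if s \<in> {0..t} then ((t - s) ^ 5 / fact 5) * D 6 s else 0) has_integral
      D 0 t - (D 0 0 + t ^ 5 / fact 5 * D 5 0)) {0..1}"
    by (subst has_integral_restrict[OF sub])
  have R2: "((\<lambda>s. t ^ 5 / fact 5 * ((1 - s) ^ 3 * h s)) has_integral t ^ 5 / fact 5 * D 5 0) {0..1}"
    using has_integral_mult_right[OF I, of "t ^ 5 / fact 5"] D21 by simp
  have "(if s \<in> {0..t} then ((t - s) ^ 5 / fact 5) * D 6 s else 0)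
      + t ^ 5 / fact 5 * ((1 - s) ^ 3 * h s) = G t s * h s" if "s \<in> {0..1}" for s
    using that by (simp add: G_def D6[OF that] left_diff_distrib diff_divide_distrib)
  with has_integral_add[OF R1 R2]
  have "((\<lambda>s. G t s * h s) has_integral
      D 0 t - (D 0 0 + t ^ 5 / fact 5 * D 5 0) + t ^ 5 / fact 5 * D 5 0) {0..1}"
    by (rule has_integral_eq[rotated])
  moreover have "D 0 t - (D 0 0 + t ^ 5 / fact 5 * D 5 0) + t ^ 5 / fact 5 * D 5 0 = D 0 t - D 0 0"
    by simp
  ultimately have "((\<lambda>s. G t s * h s) has_integral D 0 t - D 0 0) {0..1}"
    by (simp only:)
  then show "D 0 t = D 0 0 + integral {0..1} (\<lambda>s. G t s * h s)"
    by (simp add: integral_unique)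
qed

section \<open>Integrals against the kernel\<close>

lemma continuous_on_integral_G:
  assumes "continuous_on {0..1} h"
  shows "continuous_on S (\<lambda>t. integral {0..1} (\<lambda>s. G t s * h s))"
proof -
  have "continuous_on (S \<times> cbox 0 1) (\<lambda>(t, s). G t s * h s)"
    unfolding case_prod_unfold
    by (intro continuous_intros continuous_on_compose2[OF assms]) auto
  from integral_continuous_on_param[OF this] show ?thesis by simp
qed

text \<open>Fubini for a continuous integrand on a rectangle. It turns the integral of a solution
  between two nodes into an integral of \<open>h\<close> against a single kernel, the one measured
  in \<open>Phi\<close>.\<close>

lemma integral_integral_G_swap:
  assumes "continuous_on {0..1} h"
  shows "integral {a..b} (\<lambda>t. integral {0..1} (\<lambda>s. G t s * h s)) =
    integral {0..1} (\<lambda>s. integral {a..b} (\<lambda>t. G t s) * h s)"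
proof -
  have "continuous_on (cbox (a, 0) (b, 1)) (\<lambda>(t, s). G t s * h s)"
    unfolding case_prod_unfold
    by (intro continuous_intros continuous_on_compose2[OF assms]) (auto simp: cbox_Pair_eq)
  from integral_swap_continuous[OF this] show ?thesis by simp
qed

text \<open>The difference is at most \<open>B\<close> times the integral of
  \<open>\<bar>K s\<bar>\<close>, to which the norm comparison applies.\<close>

lemma abs_integral_kernel_diff_le:
  fixes K h1 h2 :: "real \<Rightarrow> real"
  assumes K: "continuous_on {0..1} K"
    and h: "continuous_on {0..1} h1" "continuous_on {0..1} h2"
    and B: "\<And>s. s \<in> {0..1} \<Longrightarrow> \<bar>h1 s - h2 s\<bar> \<le> B"
    and p: "p > 1"
  shows "\<bar>integral {0..1} (\<lambda>s. K s * h1 s) - integral {0..1} (\<lambda>s. K s * h2 s)\<bar>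
    \<le> (integral {0..1} (\<lambda>s. \<bar>K s\<bar> powr p)) powr (1 / p) * B"
proof -
  have "B \<ge> 0" by (rule order_trans[OF abs_ge_zero B[of 0]]) simp
  have "integral {0..1} (\<lambda>s. K s * h1 s) - integral {0..1} (\<lambda>s. K s * h2 s)
      = integral {0..1} (\<lambda>s. K s * (h1 s - h2 s))"
    unfolding right_diff_distrib
    by (intro integral_diff[symmetric] integrable_continuous_real continuous_intros K h)
  also have "\<bar>\<dots>\<bar> \<le> integral {0..1} (\<lambda>s. \<bar>K s\<bar> * B)"
    unfolding real_norm_def[symmetric]
    by (intro integral_norm_bound_integral integrable_continuous_real continuous_intros K h)
       (auto simp: abs_mult intro!: mult_left_mono B)
  also have "\<dots> = integral {0..1} (\<lambda>s. \<bar>K s\<bar>) * B" by simp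
  also have "\<dots> \<le> (integral {0..1} (\<lambda>s. \<bar>K s\<bar> powr p)) powr (1 / p) * B"
    using integral_abs_le_powr_mean[OF K p] \<open>B \<ge> 0\<close> by (rule mult_right_mono)
  finally show ?thesis .
qed

section \<open>The nonlocal condition and equivalence with a fixed point equation\<close>

locale nonlocal_nodes =
  fixes m :: nat and \<eta> \<alpha> \<beta> :: "nat \<Rightarrow> real"
  assumes eta_1_pos: "0 < \<eta> 1"
    and strict_mono_eta: "strict_mono_on {1..m} \<eta>"
    and eta_m_le_1: "\<eta> m \<le> 1"
    and mu_nonzero: "mu m \<eta> \<alpha> \<beta> \<noteq> 0"
begin

lemma eta_mono: "1 \<le> i \<Longrightarrow> i \<le> j \<Longrightarrow> j \<le> m \<Longrightarrow> \<eta> i \<le> \<eta> j"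
  using strict_mono_on_leD[OF strict_mono_eta, of i j] by simp

lemma eta_in_unit: "i \<in> {1..m} \<Longrightarrow> \<eta> i \<in> {0..1}"
  using eta_mono[of 1 i] eta_mono[of i m] eta_1_pos eta_m_le_1 by auto

text \<open>The value \<open>u 0\<close> forced by the nonlocal condition on a solution of \<open>u\<^sup>(\<^sup>6\<^sup>) = - h\<close>.\<close>

definition nonlocal_value :: "(real \<Rightarrow> real) \<Rightarrow> real" where
  "nonlocal_value h = 1 / mu m \<eta> \<alpha> \<beta> *
     ((\<Sum>i=1..m-1. \<alpha> i * integral {0..1} (\<lambda>s. integral {\<eta> i..\<eta> (i + 1)} (\<lambda>\<tau>. G \<tau> s) * h s))
      + (\<Sum>i=1..m. \<beta> i * integral {0..1} (\<lambda>s. G (\<eta> i) s * h s)))"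

text \<open>Inserting the representation of \<open>u\<close> into both sums, \<open>c\<close>
  appears with coefficient \<open>1 - mu m \<eta> \<alpha> \<beta>\<close>. The condition becomes a
  linear equation for \<open>c\<close>, uniquely solvable because \<open>mu\<close> is
  nonzero.\<close>

lemma nonlocal_condition_iff:
  assumes h: "continuous_on {0..1} h"
    and u: "\<And>t. t \<in> {0..1} \<Longrightarrow> u t = c + integral {0..1} (\<lambda>s. G t s * h s)"
  shows "c = (\<Sum>i=1..m-1. \<alpha> i * integral {\<eta> i..\<eta> (i + 1)} u) + (\<Sum>i=1..m. \<beta> i * u (\<eta> i))
    \<longleftrightarrow> c = nonlocal_value h"
proof -
  let ?A = "\<Sum>i=1..m-1. \<alpha> i * integral {0..1} (\<lambda>s. integral {\<eta> i..\<eta> (i + 1)} (\<lambda>\<tau>. G \<tau> s) * h s)"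
  let ?B = "\<Sum>i=1..m. \<beta> i * integral {0..1} (\<lambda>s. G (\<eta> i) s * h s)"
  have int_u: "integral {\<eta> i..\<eta> (i + 1)} u = c * (\<eta> (i + 1) - \<eta> i)
      + integral {0..1} (\<lambda>s. integral {\<eta> i..\<eta> (i + 1)} (\<lambda>\<tau>. G \<tau> s) * h s)"
    if i: "i \<in> {1..m-1}" for i
  proof -
    have "i + 1 \<le> m" "1 \<le> i" using i by auto
    then have "\<eta> i \<le> \<eta> (i + 1)" "\<eta> i \<in> {0..1}" "\<eta> (i + 1) \<in> {0..1}"
      using eta_mono[of i "i + 1"] eta_in_unit[of i] eta_in_unit[of "i + 1"] by simp_all
    then have "integral {\<eta> i..\<eta> (i + 1)} u
        = integral {\<eta> i..\<eta> (i + 1)} (\<lambda>t. c + integral {0..1} (\<lambda>s. G t s * h s))"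
      by (intro integral_cong u) auto
    also have "\<dots> = c * (\<eta> (i + 1) - \<eta> i)
        + integral {\<eta> i..\<eta> (i + 1)} (\<lambda>t. integral {0..1} (\<lambda>s. G t s * h s))"
      using \<open>\<eta> i \<le> \<eta> (i + 1)\<close>
      by (subst integral_add)
         (auto intro!: integrable_continuous_real continuous_on_integral_G h)
    finally show ?thesis by (simp only: integral_integral_G_swap[OF h])
  qed
  have "(\<Sum>i=1..m-1. \<alpha> i * integral {\<eta> i..\<eta> (i + 1)} u)
      = (\<Sum>i=1..m-1. \<alpha> i * (\<eta> (i + 1) - \<eta> i)) * c + ?A"
    unfolding sum_distrib_right sum.distrib[symmetric]
    by (rule sum.cong[OF refl]) (simp only: int_u, simp add: algebra_simps)
  moreover have "(\<Sum>i=1..m. \<beta> i * u (\<eta> i)) = (\<Sum>i=1..m. \<beta> i) * c + ?B"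
    unfolding sum_distrib_right sum.distrib[symmetric]
    by (rule sum.cong[OF refl]) (simp only: u[OF eta_in_unit], simp add: algebra_simps)
  ultimately have "(\<Sum>i=1..m-1. \<alpha> i * integral {\<eta> i..\<eta> (i + 1)} u) + (\<Sum>i=1..m. \<beta> i * u (\<eta> i))
      = (1 - mu m \<eta> \<alpha> \<beta>) * c + (?A + ?B)"
    by (simp add: mu_def algebra_simps)
  moreover have "c = (1 - mu m \<eta> \<alpha> \<beta>) * c + S \<longleftrightarrow> c = 1 / mu m \<eta> \<alpha> \<beta> * S" for S
    using mu_nonzero by (auto simp: field_simps)
  ultimately show ?thesis by (simp only: nonlocal_value_def)
qed

definition bvp_operator :: "(real \<Rightarrow> real \<Rightarrow> real) \<Rightarrow> (real \<Rightarrow> real) \<Rightarrow> real \<Rightarrow> real" where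
  "bvp_operator f u t =
     nonlocal_value (\<lambda>s. f s (u s)) + integral {0..1} (\<lambda>s. G t s * f s (u s))"

context
  fixes f :: "real \<Rightarrow> real \<Rightarrow> real"
  assumes f: "continuous_on ({0..1} \<times> UNIV) (\<lambda>(t, x). f t x)"
begin

lemma continuous_on_rhs:
  assumes "continuous_on {0..1} u"
  shows "continuous_on {0..1} (\<lambda>s. f s (u s))"
proof -
  have "continuous_on {0..1} (\<lambda>s. (s, u s))"
    using assms by (intro continuous_intros)
  from continuous_on_compose2[OF f this] show ?thesis by auto
qed

lemma bvp_solution_imp_fixpoint:
  assumes "bvp_solution f m \<eta> \<alpha> \<beta> u"
  shows "continuous_on {0..1} u" and "t \<in> {0..1} \<Longrightarrow> u t = bvp_operator f u t"
proof -
  define D where "D j = deriv_within {0..1} j u" for j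
  have D: "(D j has_vector_derivative D (Suc j) t) (at t within {0..1})"
    if "j < 6" "t \<in> {0..1}" for j t
    using assms that unfolding D_def bvp_solution_def by (blast intro: Ck_on_has_vector_derivative)
  have u: "D 0 = u" by (simp add: D_def)
  show contu: "continuous_on {0..1} u"
    using D[of 0] unfolding u by (intro continuous_on_vector_derivative) auto
  define h where "h = (\<lambda>s. f s (u s))"
  have h: "continuous_on {0..1} h"
    unfolding h_def by (rule continuous_on_rhs[OF contu])
  have "continuous_on {0..1} (D 6)"
    using assms by (simp add: bvp_solution_def Ck_on_def D_def)
  then have c: "continuous_on {0..1} (\<lambda>t. D 6 t + h t)"
    using h by (rule continuous_on_add)
  \<comment> \<open>The differential equation is given only on the open interval; continuity carries
    it to both endpoints.\<close>
  have "D 6 t + h t = 0" if "t \<in> {0..1}" for t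
  proof -
    have "closure {0<..<1::real} = {0..1}" by simp
    then show ?thesis
      using continuous_constant_on_closure[of "{0<..<1}" "\<lambda>t. D 6 t + h t" 0 t] c that assms
      by (simp add: bvp_solution_def D_def h_def)
  qed
  then have D6: "D 6 t = - h t" if "t \<in> {0..1}" for t
    using that by (simp add: eq_neg_iff_add_eq_0)
  have D0: "D j 0 = 0" if "j \<in> {1..4}" for j
    using assms that by (simp add: bvp_solution_def D_def)
  have D21: "D 2 1 = 0"
    using assms unfolding bvp_solution_def D_def by blast
  have ueq: "u t = u 0 + integral {0..1} (\<lambda>s. G t s * h s)" if "t \<in> {0..1}" for t
    using G_chain_D0[where D = D, OF D D6 h D0 D21 that] u by simp
  have "u 0 = nonlocal_value h"
    using nonlocal_condition_iff[OF h ueq] assms by (simp add: bvp_solution_def)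
  with ueq show "u t = bvp_operator f u t" if "t \<in> {0..1}"
    using that by (simp add: bvp_operator_def h_def)
qed

text \<open>Smoothness comes from integrating \<open>- h\<close> six times with suitable initial
  values. The resulting \<open>D 0\<close> has the same integral representation as \<open>u\<close>,
  so the two agree on \<open>{0..1}\<close>.\<close>

lemma fixpoint_imp_bvp_solution:
  assumes contu: "continuous_on {0..1} u"
    and fixpt: "\<And>t. t \<in> {0..1} \<Longrightarrow> u t = bvp_operator f u t"
  shows "bvp_solution f m \<eta> \<alpha> \<beta> u"
proof -
  define h where "h = (\<lambda>s. f s (u s))"
  have h: "continuous_on {0..1} h"
    unfolding h_def by (rule continuous_on_rhs[OF contu])
  \<comment> \<open>The entry at 0 encodes the nonlocal condition. The entry at 5 is the value for
    which \<open>G_chain_D2\<close> gives \<open>D 2 1 = 0\<close>, and the zeros are the conditions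
    on derivatives 1 to 4.\<close>
  define c where "c j = (if j = 0 then nonlocal_value h
    else if j = 5 then integral {0..1} (\<lambda>s. (1 - s) ^ 3 * h s) else 0)" for j :: nat
  have "continuous_on {0..1} (\<lambda>t. - h t)" using h by (rule continuous_on_minus)
  from exists_antiderivative_chain[OF this, of 6 c] obtain D
    where D6: "D 6 = (\<lambda>t. - h t)" and Dc: "\<And>j. j < 6 \<Longrightarrow> D j 0 = c j"
      and D: "\<And>j t. j < 6 \<Longrightarrow> t \<in> {0..1} \<Longrightarrow>
        (D j has_vector_derivative D (Suc j) t) (at t within {0..1})"
    by blast
  have D0: "D j 0 = 0" if "j \<in> {1..4}" for j
    using Dc[of j] that by (simp add: c_def)
  have "6 * D 2 1 = 0"
    by (subst G_chain_D2[where D = D and h = h]) (use D D6 h D0 Dc in \<open>auto simp: c_def\<close>)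
  then have D21: "D 2 1 = 0" by simp
  have "D 0 t = D 0 0 + integral {0..1} (\<lambda>s. G t s * h s)" if "t \<in> {0..1}" for t
    by (rule G_chain_D0[where D = D, OF D]) (use D6 h D0 D21 that in auto)
  then have D0u: "u t = D 0 t" if "t \<in> {0..1}" for t
    using fixpt[OF that] that Dc[of 0] by (simp add: bvp_operator_def h_def c_def)
  have deriv: "deriv_within {0..1} j u t = D j t" if "j \<le> 6" "t \<in> {0..1}" for j t
    by (rule deriv_within_eq[where D = D, OF _ D D0u]) (use that in auto)
  have ueq: "u t = nonlocal_value h + integral {0..1} (\<lambda>s. G t s * h s)" if "t \<in> {0..1}" for t
    using fixpt[OF that] by (simp add: bvp_operator_def h_def)
  show ?thesis
    unfolding bvp_solution_def
  proof (intro conjI ballI)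
    show "Ck_on 6 {0..1} u"
      by (rule Ck_onI[where D = D, OF _ D D0u]) (use D6 h in \<open>auto intro: continuous_on_minus\<close>)
    show "deriv_within {0..1} 6 u t + f t (u t) = 0" if "t \<in> {0<..<1}" for t
      using that by (simp add: deriv D6 h_def)
    show "deriv_within {0..1} j u 0 = 0" if "j \<in> {1..4}" for j
      using that by (simp add: deriv D0)
    show "deriv_within {0..1} 2 u 1 = 0"
      by (simp add: deriv D21)
    show "u 0 = (\<Sum>i=1..m-1. \<alpha> i * integral {\<eta> i..\<eta> (i + 1)} u) + (\<Sum>i=1..m. \<beta> i * u (\<eta> i))"
      using nonlocal_condition_iff[OF h ueq] D0u[of 0] Dc[of 0] by (simp add: c_def)
  qed
qed

section \<open>The contraction estimate\<close>

lemma continuous_on_bvp_operator: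
  "continuous_on {0..1} u \<Longrightarrow> continuous_on {0..1} (bvp_operator f u)"
  unfolding bvp_operator_def [abs_def]
  by (intro continuous_on_add continuous_on_const continuous_on_integral_G continuous_on_rhs)

text \<open>The difference of the two images is a linear combination of integrals against the
  kernels in \<open>Phi\<close>, except that \<open>G t\<close> occurs where \<open>Phi\<close> has
  \<open>G 1\<close>. Each integral is bounded by the norm of its kernel times
  \<open>L * M\<close>.\<close>

lemma bvp_operator_contraction:
  assumes u: "continuous_on {0..1} u" and v: "continuous_on {0..1} v"
    and "L \<ge> 0"
    and lip: "\<And>t x y. t \<in> {0..1} \<Longrightarrow> \<bar>f t x - f t y\<bar> \<le> L * \<bar>x - y\<bar>"
    and p: "p > 1"
    and M: "\<And>s. s \<in> {0..1} \<Longrightarrow> \<bar>u s - v s\<bar> \<le> M"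
    and t: "t \<in> {0..1}"
  shows "\<bar>bvp_operator f u t - bvp_operator f v t\<bar> \<le> L * Phi p m \<eta> \<alpha> \<beta> * M"
proof -
  define hu hv where "hu = (\<lambda>s. f s (u s))" and "hv = (\<lambda>s. f s (v s))"
  have h: "continuous_on {0..1} hu" "continuous_on {0..1} hv"
    unfolding hu_def hv_def by (intro continuous_on_rhs u v)+
  have hM: "\<bar>hu s - hv s\<bar> \<le> L * M" if "s \<in> {0..1}" for s
    unfolding hu_def hv_def
    using lip[OF that] mult_left_mono[OF M[OF that] \<open>L \<ge> 0\<close>] by (rule order_trans)
  define N where "N K = (integral {0..1} (\<lambda>s. \<bar>K s\<bar> powr p)) powr (1 / p)" for K :: "real \<Rightarrow> real"
  define d where "d K = integral {0..1} (\<lambda>s. K s * hu s) - integral {0..1} (\<lambda>s. K s * hv s)" for K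
  have d: "\<bar>d K\<bar> \<le> N K * (L * M)" if "continuous_on {0..1} K" for K
    unfolding d_def N_def by (rule abs_integral_kernel_diff_le[OF that h hM p])
  have contG: "continuous_on S (G \<tau>)" for \<tau> S
    using continuous_on_G_compose[of S "\<lambda>_. \<tau>" "\<lambda>s. s"] by simp
  have "continuous_on (S \<times> cbox a b) (\<lambda>(s, \<tau>). G \<tau> s)" for S and a b :: real
    unfolding case_prod_unfold by (intro continuous_intros)
  from integral_continuous_on_param[OF this]
  have contI: "continuous_on S (\<lambda>s. integral {a..b} (\<lambda>\<tau>. G \<tau> s))" for S a b by simp
  have "M \<ge> 0" by (rule order_trans[OF abs_ge_zero M[of 0]]) simp
  define c where "c = 1 / \<bar>mu m \<eta> \<alpha> \<beta>\<bar>"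
  have "c \<ge> 0" by (simp add: c_def)
  have int: "(\<lambda>s. \<bar>G \<tau> s\<bar> powr p) integrable_on {0..1}" for \<tau>
    using p by (intro integrable_continuous_real continuous_on_powr' continuous_intros contG) auto
  \<comment> \<open>Monotonicity up to \<open>t = 1\<close> makes the bound uniform in
    \<open>t\<close> and gives the first term of \<open>Phi\<close>.\<close>
  have "\<bar>G t s\<bar> powr p \<le> \<bar>G 1 s\<bar> powr p" if "s \<in> {0..1}" for s
    using G_nonneg[OF t that] G_le_G1[OF t that] p by (intro powr_mono2) auto
  then have "integral {0..1} (\<lambda>s. \<bar>G t s\<bar> powr p) \<le> integral {0..1} (\<lambda>s. \<bar>G 1 s\<bar> powr p)"
    by (rule integral_le[OF int int])
  moreover have "0 \<le> integral {0..1} (\<lambda>s. \<bar>G t s\<bar> powr p)"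
    by (rule integral_nonneg[OF int]) simp
  ultimately have "N (G t) \<le> N (G 1)"
    unfolding N_def using p by (intro powr_mono2) auto
  then have dG: "\<bar>d (G t)\<bar> \<le> N (G 1) * (L * M)"
    using d[OF contG, of t] \<open>L \<ge> 0\<close> \<open>M \<ge> 0\<close> by (meson mult_nonneg_nonneg mult_right_mono order_trans)
  define J where "J i = (\<lambda>s. integral {\<eta> i..\<eta> (i + 1)} (\<lambda>\<tau>. G \<tau> s))" for i
  define A where "A = (\<Sum>i=1..m-1. \<bar>\<alpha> i\<bar> * N (J i))"
  define B where "B = (\<Sum>i=1..m. \<bar>\<beta> i\<bar> * N (G (\<eta> i)))"
  have sumJ: "(\<Sum>i=1..m-1. \<alpha> i * d (J i)) =
      (\<Sum>i=1..m-1. \<alpha> i * integral {0..1} (\<lambda>s. J i s * hu s))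
      - (\<Sum>i=1..m-1. \<alpha> i * integral {0..1} (\<lambda>s. J i s * hv s))"
    by (simp only: d_def right_diff_distrib sum_subtractf)
  have sumG: "(\<Sum>i=1..m. \<beta> i * d (G (\<eta> i))) =
      (\<Sum>i=1..m. \<beta> i * integral {0..1} (\<lambda>s. G (\<eta> i) s * hu s))
      - (\<Sum>i=1..m. \<beta> i * integral {0..1} (\<lambda>s. G (\<eta> i) s * hv s))"
    by (simp only: d_def right_diff_distrib sum_subtractf)
  have "nonlocal_value hu - nonlocal_value hv =
      1 / mu m \<eta> \<alpha> \<beta> * ((\<Sum>i=1..m-1. \<alpha> i * d (J i)) + (\<Sum>i=1..m. \<beta> i * d (G (\<eta> i))))"
    unfolding sumJ sumG unfolding nonlocal_value_def J_def
    by (simp only: right_diff_distrib[symmetric] add_diff_add)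
  also have "\<bar>\<dots>\<bar> = c * \<bar>(\<Sum>i=1..m-1. \<alpha> i * d (J i)) + (\<Sum>i=1..m. \<beta> i * d (G (\<eta> i)))\<bar>"
    by (simp only: c_def abs_mult abs_divide abs_one)
  also have "\<dots> \<le> c * (A * (L * M) + B * (L * M))"
  proof (rule mult_left_mono[OF order_trans[OF abs_triangle_ineq add_mono] \<open>c \<ge> 0\<close>])
    have "\<bar>\<alpha> i * d (J i)\<bar> \<le> \<bar>\<alpha> i\<bar> * N (J i) * (L * M)" for i
      unfolding abs_mult mult.assoc J_def by (intro mult_left_mono d contI abs_ge_zero)
    then show "\<bar>\<Sum>i=1..m-1. \<alpha> i * d (J i)\<bar> \<le> A * (L * M)"
      unfolding A_def sum_distrib_right by (intro order_trans[OF sum_abs] sum_mono)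
    have "\<bar>\<beta> i * d (G (\<eta> i))\<bar> \<le> \<bar>\<beta> i\<bar> * N (G (\<eta> i)) * (L * M)" for i
      unfolding abs_mult mult.assoc by (intro mult_left_mono d contG abs_ge_zero)
    then show "\<bar>\<Sum>i=1..m. \<beta> i * d (G (\<eta> i))\<bar> \<le> B * (L * M)"
      unfolding B_def sum_distrib_right by (intro order_trans[OF sum_abs] sum_mono)
  qed
  finally have "\<bar>nonlocal_value hu - nonlocal_value hv\<bar> \<le> c * (A * (L * M) + B * (L * M))" .
  moreover have "bvp_operator f u t - bvp_operator f v t =
      nonlocal_value hu - nonlocal_value hv + d (G t)"
    by (simp add: bvp_operator_def hu_def hv_def d_def)
  moreover have "Phi p m \<eta> \<alpha> \<beta> = N (G 1) + c * A + c * B"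
    by (simp only: Phi_def N_def c_def A_def B_def J_def)
  then have "L * Phi p m \<eta> \<alpha> \<beta> * M = N (G 1) * (L * M) + c * (A * (L * M) + B * (L * M))"
    by (simp add: algebra_simps)
  ultimately show ?thesis
    using dG by linarith
qed

end

end

section \<open>Existence and uniqueness of the solution\<close>

theorem theorem3p3:
  fixes m :: nat and \<eta> \<alpha> \<beta> :: "nat \<Rightarrow> real"
    and f :: "real \<Rightarrow> real \<Rightarrow> real" and L p :: real
  assumes "m \<ge> 2"
    and "0 < \<eta> 1" and "strict_mono_on {1..m} \<eta>" and "\<eta> m \<le> 1"
    and "mu m \<eta> \<alpha> \<beta> \<noteq> 0"
    and "continuous_on ({0..1} \<times> UNIV) (\<lambda>(t, x). f t x)"
    and "L > 0"
    and "\<And>t u1 u2. t \<in> {0..1} \<Longrightarrow> \<bar>f t u1 - f t u2\<bar> \<le> L * \<bar>u1 - u2\<bar>"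
    and "p > 1"
    and "L * Phi p m \<eta> \<alpha> \<beta> < 1"
  shows "\<exists>u. bvp_solution f m \<eta> \<alpha> \<beta> u \<and>
           (\<forall>v. bvp_solution f m \<eta> \<alpha> \<beta> v \<longrightarrow> (\<forall>t\<in>{0..1}. v t = u t))"
proof -
  interpret nonlocal_nodes m \<eta> \<alpha> \<beta>
    using assms by unfold_locales
  note f = assms(6)
  have "Phi p m \<eta> \<alpha> \<beta> \<ge> 0"
    unfolding Phi_def by (intro add_nonneg_nonneg mult_nonneg_nonneg sum_nonneg) auto
  then have Phi: "0 \<le> L * Phi p m \<eta> \<alpha> \<beta>"
    using \<open>L > 0\<close> by simp
  have contr: "\<bar>bvp_operator f u t - bvp_operator f v t\<bar> \<le> L * Phi p m \<eta> \<alpha> \<beta> * M"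
    if "continuous_on {0..1} u" "continuous_on {0..1} v"
      "\<And>s. s \<in> {0..1} \<Longrightarrow> \<bar>u s - v s\<bar> \<le> M" "t \<in> {0..1}" for u v M t
    by (rule bvp_operator_contraction[OF f that(1,2) _ assms(8) \<open>p > 1\<close> that(3,4)])
       (use \<open>L > 0\<close> in auto)
  have "\<exists>u. continuous_on {0..1} u \<and> (\<forall>t\<in>{0..1}. u t = bvp_operator f u t) \<and>
    (\<forall>v. continuous_on {0..1} v \<and> (\<forall>t\<in>{0..1}. v t = bvp_operator f v t) \<longrightarrow> (\<forall>t\<in>{0..1}. v t = u t))"
    by (rule contraction_on_continuous_fixpoint[where T = "bvp_operator f",
          OF zero_le_one Phi \<open>L * Phi p m \<eta> \<alpha> \<beta> < 1\<close>]; fact continuous_on_bvp_operator[OF f] contr)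
  then obtain u where u: "continuous_on {0..1} u" "\<forall>t\<in>{0..1}. u t = bvp_operator f u t"
    and uniq: "\<forall>v. continuous_on {0..1} v \<and> (\<forall>t\<in>{0..1}. v t = bvp_operator f v t) \<longrightarrow>
      (\<forall>t\<in>{0..1}. v t = u t)"
    by (elim exE conjE) (rule that)
  show ?thesis
  proof (intro exI conjI allI impI ballI)
    show "bvp_solution f m \<eta> \<alpha> \<beta> u"
      by (rule fixpoint_imp_bvp_solution[OF f u(1) bspec[OF u(2)]])
    \<comment> \<open>Every solution is a continuous fixed point, so uniqueness among continuous
      fixed points suffices.\<close>
    show "v t = u t" if v: "bvp_solution f m \<eta> \<alpha> \<beta> v" and t: "t \<in> {0..1}" for v t
      using uniq bvp_solution_imp_fixpoint[OF f v] t by blast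
  qed
qed

end
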